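(* Let $\tilde P_c\in\partial\mathcal F$. Then there exist unique vectors $\tilde V_L\in\partial\mathcal D$ and $\lambda\in\Lambda_1$ such that $\tilde P_c=P_c(\tilde V_L)$ and $\tilde V_L=\varphi(\lambda)$. These vectors satisfy $$\tilde P_c=[\varphi(\lambda)][\lambda]^{-1}Y_{LL}[\lambda]\varphi(\lambda).$$ This implies that the boundary of $\mathcal F$ is parametrized by $$\partial\mathcal F=\{\,[\varphi(\lambda)][\lambda]^{-1}Y_{LL}[\lambda]\varphi(\lambda)\;:\;\lambda\in\Lambda_1\,\}.$$
   Context: Notation: $[x]=\operatorname{diag}(x_1,\dots,x_k)$ for a vector $x$; $\mathbf 1,\mathbf 0$ are the all-ones and all-zeros vectors; vector and matrix inequalities are element-wise; $\|\cdot\|_1$ is the 1-norm. Setting: a DC power grid with $n\ge1$ loads and $m\ge1$ sources. Its Kirchhoff matrix $Y=\begin{pmatrix} Y_{LL} & Y_{LS} \\ Y_{SL} & Y_{SS} \end{pmatrix}\in\mathbb R^{(n+m)\times(n+m)}$ is the weighted Laplacian of a connected undirected graph with positive edge weights (symmetric, nonpositive off-diagonal entries, zero row sums), partitioned according to loads and sources, and the $n\times n$ matrix $Y_{LL}$ is irreducible; hence $Y_{LL}$ is symmetric positive definite with nonpositive off-diagonal entries. The source voltages $V_S\in\mathbb R^m$, $V_S>\mathbf 0$, are fixed. Put $\mathcal I_L^*=-Y_{LS}V_S$ (which satisfies $\mathcal I_L^*\ge\mathbf 0$, $\mathcal I_L^*\ne\mathbf 0$) and $V_L^*=Y_{LL}^{-1}\mathcal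 I_L^*$ (which satisfies $V_L^*>\mathbf 0$). For $V_L\in\mathbb R^n$ put $P_c(V_L)=[V_L]Y_{LL}(V_L^*-V_L)$, with Jacobian $\frac{\partial P_c}{\partial V_L}(V_L)=[Y_{LL}(V_L^*-V_L)]-[V_L]Y_{LL}$. The set of feasible power demands is $\mathcal F=\{P_c(V_L): V_L\in\mathbb R^n,\ V_L>\mathbf 0\}$, with boundary $\partial\mathcal F$ in $\mathbb R^n$. $\mathcal D$ is the set of all $V_L>\mathbf 0$ such that $\frac{\partial P_c}{\partial V_L}(V_L)$ is nonsingular and its inverse has only negative entries; $\partial\mathcal D$ is its boundary in $\mathbb R^n$. For $\lambda\in\mathbb R^n$ put $h(\lambda)=\tfrac12([\lambda]Y_{LL}+Y_{LL}[\lambda])$. $\Lambda=\{\lambda\in\mathbb R^n: h(\lambda)\text{ is positive definite}\}$ and $\Lambda_1=\{\lambda\in\Lambda:\|\lambda\|_1=1\}$ (elements of $\Lambda$ are positive vectors). For $\lambda\in\Lambda$ put $\varphi(\lambda)=\tfrac12 h(\lambda)^{-1}[\lambda]\mathcal I_L^*$. *)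

theory Defs
  imports "HOL-Analysis.Analysis"
begin

definition diag :: "real^'n \<Rightarrow> real^'n^'n" where
  "diag x = (\<chi> i j. if i = j then x $ i else 0)"

text \<open>Strict element-wise positivity. The library order \<open><\<close> on \<^typ>\<open>real^'n\<close> is not the
  element-wise one: \<open>x < y\<close> there only means \<open>x \<le> y\<close> and \<open>x \<noteq> y\<close>.\<close>

definition pos_vec :: "real^'n \<Rightarrow> bool" where
  "pos_vec x \<longleftrightarrow> (\<forall>i. 0 < x $ i)"

text \<open>The 1-norm; \<^const>\<open>norm\<close> on \<^typ>\<open>real^'n\<close> is the Euclidean one.\<close>

definition norm_one :: "real^'n \<Rightarrow> real" where
  "norm_one x = (\<Sum>i\<in>UNIV. \<bar>x $ i\<bar>)"

definition pos_definite :: "real^'n^'n \<Rightarrow> bool" where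
  "pos_definite A \<longleftrightarrow> transpose A = A \<and> (\<forall>x. x \<noteq> 0 \<longrightarrow> 0 < x \<bullet> (A *v x))"

text \<open>\<open>A\<close> is reducible iff a simultaneous permutation of its rows and columns gives it a zero
  off-diagonal block with nonempty diagonal blocks; \<open>K\<close> is the index set of one of these blocks.
  Every \<open>1 \<times> 1\<close> matrix is irreducible.\<close>

definition irreducible_matrix :: "real^'n^'n \<Rightarrow> bool" where
  "irreducible_matrix A \<longleftrightarrow>
     \<not> (\<exists>K. K \<noteq> {} \<and> K \<noteq> UNIV \<and> (\<forall>i\<in>K. \<forall>j\<in>-K. A $ i $ j = 0))"

definition laplacian :: "('v::finite \<times> 'v) set \<Rightarrow> ('v \<Rightarrow> 'v \<Rightarrow> real) \<Rightarrow> real^'v^'v" where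
  "laplacian E w = (\<chi> i j. if i = j then (\<Sum>k\<in>{k. (i, k) \<in> E}. w i k)
                           else if (i, j) \<in> E then - w i j else 0)"

text \<open>An undirected graph is given by its symmetric irreflexive set of arcs \<open>E\<close> and is connected
  iff any two vertices are related by \<open>E\<^sup>*\<close>.\<close>

definition kirchhoff :: "real^'v^'v \<Rightarrow> bool" where
  "kirchhoff Y \<longleftrightarrow> (\<exists>E w.
     sym E \<and> irrefl E \<and> (\<forall>i j. (i, j) \<in> E\<^sup>*) \<and>
     (\<forall>i j. (i, j) \<in> E \<longrightarrow> 0 < w i j \<and> w i j = w j i) \<and>
     Y = laplacian E w)"

lemma kirchhoff_symmetric: "kirchhoff Y \<Longrightarrow> transpose Y = Y"
  by (auto simp: kirchhoff_def laplacian_def transpose_def vec_eq_iff dest: symD)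

lemma kirchhoff_off_diagonal:
  assumes "kirchhoff Y" "i \<noteq> j"
  shows "Y $ i $ j \<le> 0"
  using assms by (fastforce simp: kirchhoff_def laplacian_def)

lemma kirchhoff_row_sums:
  assumes "kirchhoff Y"
  shows "(\<Sum>j\<in>UNIV. Y $ i $ j) = 0"
proof -
  from assms obtain E w where E: "irrefl E" and Y: "Y = laplacian E w"
    by (auto simp: kirchhoff_def)
  have ii: "(i, i) \<notin> E" using E by (simp add: irrefl_def)
  have "(\<Sum>j\<in>UNIV. Y $ i $ j) = Y $ i $ i + (\<Sum>j\<in>UNIV-{i}. Y $ i $ j)"
    by (simp add: sum.remove)
  also have "(\<Sum>j\<in>UNIV-{i}. Y $ i $ j) = (\<Sum>j\<in>UNIV-{i}. if (i, j) \<in> E then - w i j else 0)"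
    by (intro sum.cong) (auto simp: Y laplacian_def)
  also have "\<dots> = (\<Sum>j\<in>{j. (i, j) \<in> E}. - w i j)"
    using ii by (intro sum.mono_neutral_cong_right) auto
  finally show ?thesis by (simp add: Y laplacian_def sum_negf)
qed

text \<open>The vertex type of a grid is \<^typ>\<open>'n + 'm\<close>: loads are indexed by \<^typ>\<open>'n\<close>,
  sources by \<^typ>\<open>'m\<close>. All notions below depend on the Kirchhoff matrix \<open>Y\<close> and the source
  voltages \<open>VS\<close>.\<close>

definition Y_LL :: "real^('n::finite + 'm::finite)^('n + 'm) \<Rightarrow> real^'n^'n" where
  "Y_LL Y = (\<chi> i j. Y $ Inl i $ Inl j)"

definition Y_LS :: "real^('n::finite + 'm::finite)^('n + 'm) \<Rightarrow> real^'m^'n" where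
  "Y_LS Y = (\<chi> i j. Y $ Inl i $ Inr j)"

definition I_star :: "real^('n::finite + 'm::finite)^('n + 'm) \<Rightarrow> real^'m \<Rightarrow> real^'n" where
  "I_star Y VS = - (Y_LS Y *v VS)"

definition V_star :: "real^('n::finite + 'm::finite)^('n + 'm) \<Rightarrow> real^'m \<Rightarrow> real^'n" where
  "V_star Y VS = matrix_inv (Y_LL Y) *v I_star Y VS"

definition P_c :: "real^('n::finite + 'm::finite)^('n + 'm) \<Rightarrow> real^'m \<Rightarrow> real^'n \<Rightarrow> real^'n" where
  "P_c Y VS V = diag V *v (Y_LL Y *v (V_star Y VS - V))"

lemma P_c_has_derivative:
  fixes Y :: "real^('n::finite + 'm::finite)^('n + 'm)" and VS :: "real^'m" and V :: "real^'n"
  shows "(P_c Y VS has_derivative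
     (\<lambda>x. (diag (Y_LL Y *v (V_star Y VS - V)) - diag V ** Y_LL Y) *v x)) (at V)"
proof -
  have d: "diag x *v y = (\<chi> i. x $ i * y $ i)" for x y :: "real^'n"
    by (simp add: diag_def matrix_vector_mult_def vec_eq_iff if_distrib if_distribR cong: if_cong)
  have nth: "((\<lambda>V. V $ i) has_derivative (\<lambda>x. x $ i)) F" for i :: 'n and F
    by (rule bounded_linear_imp_has_derivative[OF bounded_linear_vec_nth])
  have bl: "((\<lambda>V. Y_LL Y *v (V_star Y VS - V)) has_derivative (\<lambda>x. - (Y_LL Y *v x))) (at V)"
    using bounded_linear.has_derivative[OF matrix_vector_mul_bounded_linear,
        OF has_derivative_diff[OF has_derivative_const has_derivative_ident], of "Y_LL Y"]
    by (simp add: vec.neg)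
  have "((\<lambda>V. P_c Y VS V $ i) has_derivative
      (\<lambda>x. ((diag (Y_LL Y *v (V_star Y VS - V)) - diag V ** Y_LL Y) *v x) $ i)) (at V)" for i
  proof -
    have "((\<lambda>V. V $ i * (Y_LL Y *v (V_star Y VS - V)) $ i) has_derivative
        (\<lambda>x. V $ i * (- (Y_LL Y *v x)) $ i + x $ i * (Y_LL Y *v (V_star Y VS - V)) $ i)) (at V)"
      by (rule has_derivative_mult[OF nth bounded_linear.has_derivative[OF bounded_linear_vec_nth bl]])
    moreover have "(\<lambda>x. V $ i * (- (Y_LL Y *v x)) $ i + x $ i * (Y_LL Y *v (V_star Y VS - V)) $ i) =
        (\<lambda>x. ((diag (Y_LL Y *v (V_star Y VS - V)) - diag V ** Y_LL Y) *v x) $ i)"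
    proof
      fix x
      have "(diag V ** Y_LL Y) *v x = diag V *v (Y_LL Y *v x)"
        by (rule matrix_vector_mul_assoc[symmetric])
      then show "V $ i * (- (Y_LL Y *v x)) $ i + x $ i * (Y_LL Y *v (V_star Y VS - V)) $ i =
          ((diag (Y_LL Y *v (V_star Y VS - V)) - diag V ** Y_LL Y) *v x) $ i"
        by (simp only: matrix_vector_mult_diff_rdistrib d vec_lambda_beta vector_minus_component
            vector_uminus_component) simp
    qed
    ultimately show ?thesis by (simp only: P_c_def d vec_lambda_beta)
  qed
  then show ?thesis
    by (subst has_derivative_componentwise_within) (auto simp: Basis_vec_def inner_axis)
qed

lemma jacobian_P_c:
  "jacobian (P_c Y VS) (at V) = diag (Y_LL Y *v (V_star Y VS - V)) - diag V ** Y_LL Y"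
  unfolding jacobian_def frechet_derivative_at[OF P_c_has_derivative, symmetric]
  by (rule matrix_of_matrix_vector_mul)

definition feasible :: "real^('n::finite + 'm::finite)^('n + 'm) \<Rightarrow> real^'m \<Rightarrow> (real^'n) set" where
  "feasible Y VS = P_c Y VS ` {V. pos_vec V}"

definition D_set :: "real^('n::finite + 'm::finite)^('n + 'm) \<Rightarrow> real^'m \<Rightarrow> (real^'n) set" where
  "D_set Y VS = {V. pos_vec V \<and> invertible (jacobian (P_c Y VS) (at V)) \<and>
     (\<forall>i j. matrix_inv (jacobian (P_c Y VS) (at V)) $ i $ j < 0)}"

definition h_mat :: "real^('n::finite + 'm::finite)^('n + 'm) \<Rightarrow> real^'n \<Rightarrow> real^'n^'n" where
  "h_mat Y l = (1/2) *\<^sub>R (diag l ** Y_LL Y + Y_LL Y ** diag l)"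

definition Lam :: "real^('n::finite + 'm::finite)^('n + 'm) \<Rightarrow> (real^'n) set" where
  "Lam Y = {l. pos_definite (h_mat Y l)}"

definition Lam_one :: "real^('n::finite + 'm::finite)^('n + 'm) \<Rightarrow> (real^'n) set" where
  "Lam_one Y = {l \<in> Lam Y. norm_one l = 1}"

definition phi :: "real^('n::finite + 'm::finite)^('n + 'm) \<Rightarrow> real^'m \<Rightarrow> real^'n \<Rightarrow> real^'n" where
  "phi Y VS l = (1/2) *\<^sub>R (matrix_inv (h_mat Y l) *v (diag l *v I_star Y VS))"

definition boundary_demand ::
  "real^('n::finite + 'm::finite)^('n + 'm) \<Rightarrow> real^'m \<Rightarrow> real^'n \<Rightarrow> real^'n" where
  "boundary_demand Y VS l =
     (diag (phi Y VS l) ** matrix_inv (diag l) ** Y_LL Y ** diag l) *v phi Y VS l"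

end

theory Submission
  imports Defs
begin

text \<open>For positive \<open>V\<close> the Jacobian of the power map factors as \<open>- diag V ** S V\<close> with \<open>S V\<close> a
  symmetric irreducible matrix with nonpositive off-diagonal entries, so the minimizer of its Rayleigh
  quotient is a positive eigenvector and no general Perron-Frobenius theory is needed.

  If \<open>p\<close> is a boundary demand, take \<open>V\<close> of maximal sum among the nonnegative voltages that deliver at
  least \<open>p\<close>. It cannot be enlarged, which forces \<open>P V = p\<close>, \<open>V > 0\<close>, and the least eigenvalue of \<open>S V\<close>
  to be nonnegative; it is zero, since otherwise \<open>p\<close> would be interior by the open mapping property.
  The positive kernel vector \<open>diag V *v l\<close> of \<open>S V\<close> yields \<open>2 h(l) V = diag l *v I\<close>, hence \<open>h(l)\<close> is
  positive definite and \<open>V = \<phi> l\<close>. Conversely, \<open>\<phi> l\<close> is the unique maximizer of the strictly concave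
  function \<open>l \<bullet> P V\<close>; this gives both that \<open>P (\<phi> l)\<close> is a boundary point and that \<open>V\<close> is unique.\<close>

subsection \<open>Symmetric irreducible Z-matrices\<close>

text \<open>The diagonal is unconstrained, so adding a diagonal matrix does not leave the class;
  \<open>S V\<close> arises from \<open>Y_LL Y\<close> in this way.\<close>

definition irreducible_sym_Z :: "real^'n^'n \<Rightarrow> bool" where
  "irreducible_sym_Z S \<longleftrightarrow>
     transpose S = S \<and> (\<forall>i j. i \<noteq> j \<longrightarrow> S $ i $ j \<le> 0) \<and> irreducible_matrix S"

lemma diag_mult_nth [simp]: "(diag x *v y) $ i = x $ i * y $ i"
  by (simp add: diag_def matrix_vector_mult_def if_distrib if_distribR cong: if_cong)

lemma inner_symmetric_matrix:
  assumes "transpose S = S"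
  shows "x \<bullet> (S *v y) = (S *v x) \<bullet> (y :: real^'n)"
  by (metis assms dot_lmul_matrix transpose_matrix_vector)

text \<open>Here \<open>c\<close> is the largest factor keeping \<open>c *\<^sub>R y\<close> below
  \<open>x\<close>, and the two touch at \<open>i\<close>. Thus \<open>x - c *\<^sub>R y\<close> is
  nonnegative with a zero entry, the situation that \<open>nonneg_zero_or_pos\<close>
  resolves.\<close>

lemma ex_min_ratio:
  fixes x y :: "real^'n"
  assumes "pos_vec y"
  obtains c i where "\<And>j. c * y $ j \<le> x $ j" "x $ i = c * y $ i"
proof -
  define c where "c = Min (range (\<lambda>i. x $ i / y $ i))"
  have "c \<in> range (\<lambda>i. x $ i / y $ i)" unfolding c_def by (intro Min_in) auto
  then obtain i where i: "c = x $ i / y $ i" by auto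
  have y: "y $ j > 0" for j using assms by (simp add: pos_vec_def)
  have "c \<le> x $ j / y $ j" for j unfolding c_def by (intro Min_le) auto
  then have "c * y $ j \<le> x $ j" for j using y[of j] by (metis pos_le_divide_eq)
  moreover have "x $ i = c * y $ i" using i y[of i] by simp
  ultimately show ?thesis using that by blast
qed

lemma axis_nth_if: "axis i a $ j = (if j = i then a else 0)"
  by (simp add: axis_def)

lemma pos_vec_nonzero: "pos_vec x \<Longrightarrow> x $ i \<noteq> 0"
  by (metis less_irrefl pos_vec_def)

text \<open>Besides symmetry, only the signs and zeros of the off-diagonal entries matter. This
  transfers the property from \<open>Y_LL Y\<close> to \<open>S V\<close> and
  \<open>h l\<close>.\<close>

lemma irreducible_sym_Z_cong:
  assumes "irreducible_sym_Z A" "transpose B = B"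
    and "\<And>i j. i \<noteq> j \<Longrightarrow> \<exists>c>0. B $ i $ j = c * A $ i $ j"
  shows "irreducible_sym_Z B"
proof -
  have "B $ i $ j \<le> 0" if "i \<noteq> j" for i j
    using assms(1) assms(3)[OF that] that by (auto simp: irreducible_sym_Z_def mult_le_0_iff)
  moreover have "irreducible_matrix B"
    unfolding irreducible_matrix_def
  proof clarify
    fix K :: "'a set" assume K: "K \<noteq> {}" "K \<noteq> UNIV" "\<forall>i\<in>K. \<forall>j\<in>-K. B $ i $ j = 0"
    have "A $ i $ j = 0" if "i \<in> K" "j \<in> -K" for i j
    proof -
      have "i \<noteq> j" using that by auto
      then show ?thesis using assms(3)[of i j] K(3) that by auto
    qed
    moreover have "irreducible_matrix A" using assms(1) by (simp add: irreducible_sym_Z_def)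
    ultimately show False using K(1,2) unfolding irreducible_matrix_def by meson
  qed
  ultimately show ?thesis using assms(2) by (auto simp: irreducible_sym_Z_def)
qed

text \<open>A discrete strong minimum principle. If the zero set \<open>K\<close> of
  \<open>w\<close> were proper and nonempty, irreducibility would link some \<open>i\<close> in
  \<open>K\<close> to some \<open>j\<close> outside; row \<open>i\<close> of \<open>S *v w\<close>
  would then be a sum of nonpositive terms, one of them negative.\<close>

lemma nonneg_zero_or_pos:
  fixes w :: "real^'n"
  assumes S: "irreducible_sym_Z S" and w: "\<And>i. 0 \<le> w $ i"
    and Sw: "\<And>i. w $ i = 0 \<Longrightarrow> 0 \<le> (S *v w) $ i"
  shows "w = 0 \<or> pos_vec w"
proof (rule ccontr)
  assume neg: "\<not> (w = 0 \<or> pos_vec w)"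
  define K where "K = {i. w $ i = 0}"
  have "K \<noteq> UNIV" using neg by (auto simp: K_def vec_eq_iff)
  moreover have "K \<noteq> {}" using neg w by (auto simp: K_def pos_vec_def order_less_le)
  moreover have "irreducible_matrix S" using S by (simp add: irreducible_sym_Z_def)
  ultimately have "\<not> (\<forall>i\<in>K. \<forall>j\<in>-K. S $ i $ j = 0)"
    unfolding irreducible_matrix_def by meson
  then obtain i j where ij: "i \<in> K" "j \<notin> K" "S $ i $ j \<noteq> 0" by auto
  have Z: "S $ i $ k \<le> 0" if "k \<noteq> i" for k
    using S that by (auto simp: irreducible_sym_Z_def)
  have "(S *v w) $ i = (\<Sum>k\<in>UNIV. S $ i $ k * w $ k)" by (simp add: matrix_vector_mult_def)
  also have "\<dots> < (\<Sum>k\<in>(UNIV::'n set). 0)"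
  proof (rule sum_strict_mono_ex1)
    show "\<forall>k\<in>UNIV. S $ i $ k * w $ k \<le> 0"
      using Z w ij(1) by (metis K_def mem_Collect_eq mult_nonpos_nonneg mult_zero_right order_refl)
    have "S $ i $ j < 0" using Z[of j] ij by force
    moreover have "w $ j > 0" using w[of j] ij(2) by (simp add: K_def)
    ultimately show "\<exists>k\<in>UNIV. S $ i $ k * w $ k < 0" by (auto intro!: exI[of _ j] mult_neg_pos)
  qed simp
  finally show False using Sw[of i] ij(1) by (simp add: K_def)
qed

text \<open>A minimizer of the quadratic form on the unit sphere stays one after taking absolute
  values; stationarity makes it an eigenvector, and the minimum principle makes it positive. The
  sign of \<open>\<mu>\<close> is left open.\<close>

lemma perron_symmetric:
  fixes S :: "real^'n^'n"
  assumes S: "irreducible_sym_Z S"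
  obtains \<mu> y where "pos_vec y" "S *v y = \<mu> *\<^sub>R y" "\<And>x. \<mu> * (x \<bullet> x) \<le> x \<bullet> (S *v x)"
proof -
  define q where "q = (\<lambda>x. x \<bullet> (S *v x))"
  have sym: "transpose S = S" using S by (simp add: irreducible_sym_Z_def)
  have "continuous_on (sphere (0::real^'n) 1) q"
    unfolding q_def by (intro continuous_intros matrix_vector_mult_linear_continuous_on)
  then obtain x where x: "x \<in> sphere 0 1" "\<And>z. z \<in> sphere 0 1 \<Longrightarrow> q x \<le> q z"
    using continuous_attains_inf[of "sphere (0::real^'n) 1" q] by auto
  define \<mu> where "\<mu> = q x"
  have lower: "\<mu> * (z \<bullet> z) \<le> q z" for z
  proof (cases "z = 0")
    case False
    then have "\<mu> \<le> q ((1 / norm z) *\<^sub>R z)" unfolding \<mu>_def by (intro x(2)) simp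
    also have "\<dots> = q z / (z \<bullet> z)"
      by (simp add: q_def matrix_vector_mult_scaleR dot_square_norm power2_eq_square)
    finally show ?thesis using False by (simp add: pos_le_divide_eq)
  qed (simp add: q_def)
  define y :: "real^'n" where "y = (\<chi> i. \<bar>x $ i\<bar>)"
  have yy: "y \<bullet> y = x \<bullet> x" by (simp add: y_def inner_vec_def)
  have xx: "x \<bullet> x = 1" using x(1) by (simp add: dot_square_norm)
  \<comment> \<open>Absolute values keep the diagonal terms and can only lower the off-diagonal
    ones, whose coefficients are nonpositive.\<close>
  have "q y \<le> q x"
  proof -
    have "y $ i * (S $ i $ j * y $ j) \<le> x $ i * (S $ i $ j * x $ j)" for i j
    proof (cases "i = j")
      case True
      then show ?thesis using abs_mult_self_eq[of "x $ i"]
        by (simp add: y_def algebra_simps)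
    next
      case False
      then have "S $ i $ j \<le> 0" using S by (simp add: irreducible_sym_Z_def)
      moreover have "x $ i * x $ j \<le> \<bar>x $ i\<bar> * \<bar>x $ j\<bar>"
        by (metis abs_ge_self abs_mult)
      ultimately have "S $ i $ j * (\<bar>x $ i\<bar> * \<bar>x $ j\<bar>) \<le> S $ i $ j * (x $ i * x $ j)"
        by (intro mult_left_mono_neg)
      then show ?thesis by (simp add: y_def algebra_simps)
    qed
    then show ?thesis
      unfolding q_def by (auto simp: inner_vec_def matrix_vector_mult_def sum_distrib_left intro!: sum_mono)
  qed
  then have qy: "q y = \<mu>" using lower[of y] yy xx by (simp add: \<mu>_def)
  \<comment> \<open>This is half the gradient at \<open>y\<close> of
    \<open>q z - \<mu> * (z \<bullet> z)\<close>, a nonnegative function of \<open>z\<close> that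
    vanishes at \<open>y\<close>.\<close>
  define g where "g = S *v y - \<mu> *\<^sub>R y"
  have "g = 0"
  proof (rule ccontr)
    assume "g \<noteq> 0"
    define c where "c = g \<bullet> g"
    define d where "d = q g - \<mu> * c"
    \<comment> \<open>At \<open>y + t *\<^sub>R g\<close> that function equals
      \<open>t * (2 * c + t * d)\<close>. The chosen \<open>t\<close> is negative and so small that
      \<open>- (t * d) \<le> c\<close>, which makes the value negative.\<close>
    define t where "t = - c / (\<bar>d\<bar> + 1)"
    have c: "c > 0" using \<open>g \<noteq> 0\<close> by (simp add: c_def)
    have gy: "g \<bullet> (S *v y) - \<mu> * (g \<bullet> y) = c"
      unfolding c_def by (subst (3) g_def) (simp add: inner_diff_right)
    have comm: "y \<bullet> (S *v g) = g \<bullet> (S *v y)" "y \<bullet> g = g \<bullet> y"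
      by (simp_all add: inner_symmetric_matrix[OF sym, of y g] inner_commute)
    have "q (y + t *\<^sub>R g) = q y + 2 * t * (g \<bullet> (S *v y)) + t * t * q g"
      unfolding q_def by (simp add: matrix_vector_right_distrib matrix_vector_mult_scaleR
          inner_add_left inner_add_right comm distrib_left)
    moreover have "(y + t *\<^sub>R g) \<bullet> (y + t *\<^sub>R g) = 1 + 2 * t * (g \<bullet> y) + t * t * c"
      unfolding c_def by (simp add: yy xx inner_add_left inner_add_right comm(2) distrib_left)
    ultimately have "\<mu> * (1 + 2 * t * (g \<bullet> y) + t * t * c) \<le> \<mu> + 2 * t * (g \<bullet> (S *v y)) + t * t * q g"
      using lower[of "y + t *\<^sub>R g"] qy by simp
    then have "0 \<le> 2 * t * (g \<bullet> (S *v y) - \<mu> * (g \<bullet> y)) + t * t * d"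
      by (simp add: d_def algebra_simps)
    then have "0 \<le> t * (2 * c + t * d)" by (simp add: gy algebra_simps)
    moreover have "t < 0" using c by (simp add: t_def divide_neg_pos)
    ultimately have "2 * c + t * d \<le> 0" by (simp add: zero_le_mult_iff)
    moreover have "- (t * d) \<le> c"
    proof -
      have "- (t * d) \<le> \<bar>t\<bar> * \<bar>d\<bar>" by (metis abs_ge_minus_self abs_mult)
      also have "\<dots> = c * (\<bar>d\<bar> / (\<bar>d\<bar> + 1))" using c by (simp add: t_def)
      also have "\<dots> \<le> c * 1" using c by (intro mult_left_mono) auto
      finally show ?thesis by simp
    qed
    ultimately show False using c by linarith
  qed
  then have eig: "S *v y = \<mu> *\<^sub>R y" by (simp add: g_def)
  have "y = 0 \<or> pos_vec y"
  proof (rule nonneg_zero_or_pos[OF S])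
    show "0 \<le> y $ i" for i by (simp add: y_def)
    show "0 \<le> (S *v y) $ i" if "y $ i = 0" for i using that by (simp add: eig)
  qed
  moreover have "y \<noteq> 0" using yy xx by auto
  ultimately show ?thesis using that[OF _ eig] lower by (auto simp: q_def)
qed

section \<open>Positive definiteness and inverse positivity\<close>

lemma inner_pos_vec_pos:
  fixes y b :: "real^'n"
  assumes "pos_vec y" "\<And>i. 0 \<le> b $ i" "b \<noteq> 0"
  shows "0 < y \<bullet> b"
proof -
  obtain i where "b $ i \<noteq> 0" using assms(3) by (auto simp: vec_eq_iff)
  then have "0 < y $ i * b $ i" using assms(1) assms(2)[of i] by (simp add: pos_vec_def order_less_le)
  then show ?thesis unfolding inner_vec_def using assms(1,2)
    by (intro sum_pos2[of _ i]) (auto simp: pos_vec_def less_imp_le)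
qed

text \<open>Pairing \<open>S *v v\<close> with the positive eigenvector \<open>y\<close> gives
  \<open>0 < \<mu> * (y \<bullet> v)\<close>, which fixes the sign of the least eigenvalue.\<close>

lemma pos_definite_if_semipositive:
  fixes S :: "real^'n^'n"
  assumes S: "irreducible_sym_Z S" and v: "pos_vec v" "\<And>i. 0 \<le> (S *v v) $ i" "S *v v \<noteq> 0"
  shows "pos_definite S"
proof -
  obtain \<mu> y where y: "pos_vec y" "S *v y = \<mu> *\<^sub>R y" "\<And>x. \<mu> * (x \<bullet> x) \<le> x \<bullet> (S *v x)"
    by (rule perron_symmetric[OF S]) (rule that)
  have sym: "transpose S = S" using S by (simp add: irreducible_sym_Z_def)
  have "0 < y \<bullet> (S *v v)" by (rule inner_pos_vec_pos[OF y(1) v(2,3)])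
  also have "\<dots> = \<mu> * (y \<bullet> v)" by (simp add: inner_symmetric_matrix[OF sym] y(2))
  finally have "0 < \<mu> * (y \<bullet> v)" .
  moreover have "0 \<le> y \<bullet> v"
    unfolding inner_vec_def using y(1) v(1) by (intro sum_nonneg) (auto simp: pos_vec_def less_imp_le)
  ultimately have "0 < \<mu>" by (simp add: zero_less_mult_iff)
  then have "0 < x \<bullet> (S *v x)" if "x \<noteq> 0" for x
    using y(3)[of x] that by (meson inner_gt_zero_iff less_le_trans mult_pos_pos)
  then show ?thesis using sym by (simp add: pos_definite_def)
qed

lemma perron_pos_definite:
  fixes S :: "real^'n^'n"
  assumes S: "irreducible_sym_Z S" and pd: "pos_definite S"
  obtains \<mu> y where "0 < \<mu>" "pos_vec y" "S *v y = \<mu> *\<^sub>R y" "\<And>x. \<mu> * (x \<bullet> x) \<le> x \<bullet> (S *v x)"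
proof -
  obtain \<mu> y where y: "pos_vec y" "S *v y = \<mu> *\<^sub>R y" "\<And>x. \<mu> * (x \<bullet> x) \<le> x \<bullet> (S *v x)"
    by (rule perron_symmetric[OF S]) (rule that)
  have "y \<noteq> 0" using y(1) by (auto simp: pos_vec_def)
  then have "0 < y \<bullet> (S *v y)" using pd by (simp add: pos_definite_def)
  then have "0 < \<mu> * (y \<bullet> y)" by (simp add: y(2))
  then have "0 < \<mu>" using inner_ge_zero[of y] by (simp add: zero_less_mult_iff)
  then show ?thesis using that y by blast
qed

text \<open>Take the largest multiple \<open>c *\<^sub>R y\<close> of the positive eigenvector below
  \<open>x\<close>. If \<open>c \<le> 0\<close>, the difference still has a nonnegative image and a
  zero entry, so it vanishes; then \<open>S *v x\<close> is both nonnegative and nonpositive, hence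
  zero.\<close>

lemma pos_definite_inverse_positive:
  fixes S :: "real^'n^'n"
  assumes S: "irreducible_sym_Z S" "pos_definite S"
    and x: "\<And>i. 0 \<le> (S *v x) $ i" "S *v x \<noteq> 0"
  shows "pos_vec x"
proof -
  obtain \<mu> y where \<mu>: "0 < \<mu>" and y: "pos_vec y" "S *v y = \<mu> *\<^sub>R y"
    by (rule perron_pos_definite[OF S]) (rule that)
  have ypos: "0 < y $ i" for i using y(1) by (simp add: pos_vec_def)
  obtain c i where c: "\<And>j. c * y $ j \<le> x $ j" "x $ i = c * y $ i"
    using ex_min_ratio[OF y(1)] by blast
  have "0 < c"
  proof (rule ccontr)
    assume "\<not> 0 < c"
    define w where "w = x - c *\<^sub>R y"
    have Sw: "S *v w = S *v x - (c * \<mu>) *\<^sub>R y"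
      by (simp add: w_def matrix_vector_mult_diff_distrib matrix_vector_mult_scaleR y(2))
    have le: "c * \<mu> * y $ j \<le> 0" for j
      using \<open>\<not> 0 < c\<close> \<mu> ypos[of j] by (simp add: mult_nonpos_nonneg)
    have "w = 0 \<or> pos_vec w"
    proof (rule nonneg_zero_or_pos[OF S(1)])
      show "0 \<le> w $ j" for j using c(1) by (simp add: w_def)
      show "0 \<le> (S *v w) $ j" for j using x(1)[of j] le[of j] by (simp add: Sw)
    qed
    moreover have "w $ i = 0" by (simp add: w_def c(2))
    ultimately have "w = 0" by (metis less_irrefl pos_vec_def)
    then have eq: "S *v x = (c * \<mu>) *\<^sub>R y" using Sw by simp
    have "(S *v x) $ j = 0" for j using x(1)[of j] le[of j] by (simp add: eq)
    then show False using x(2) by (simp add: vec_eq_iff)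
  qed
  then show ?thesis using c(1) ypos unfolding pos_vec_def by (meson less_le_trans mult_pos_pos)
qed

text \<open>Subtracting the largest multiple of \<open>v\<close> below \<open>u\<close> leaves a
  nonnegative kernel vector with a zero entry, which the minimum principle forces to be
  zero.\<close>

lemma positive_kernel_unique:
  fixes S :: "real^'n^'n"
  assumes S: "irreducible_sym_Z S" and "pos_vec v" "S *v v = 0" "S *v u = 0"
  obtains c where "u = c *\<^sub>R v"
proof -
  obtain c i where c: "\<And>j. c * v $ j \<le> u $ j" "u $ i = c * v $ i"
    using ex_min_ratio[OF assms(2)] by blast
  have "u - c *\<^sub>R v = 0 \<or> pos_vec (u - c *\<^sub>R v)"
    by (rule nonneg_zero_or_pos[OF S])
      (simp_all add: c(1) matrix_vector_mult_diff_distrib matrix_vector_mult_scaleR assms(3,4))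
  moreover have "\<not> pos_vec (u - c *\<^sub>R v)" using c(2) by (auto simp: pos_vec_def intro!: exI[of _ i])
  ultimately have "u = c *\<^sub>R v" by simp
  then show ?thesis by (rule that)
qed

section \<open>Kernels and inverses\<close>

lemma invertible_if_kernel_trivial:
  fixes A :: "real^'n^'n"
  assumes "\<And>x. A *v x = 0 \<Longrightarrow> x = 0"
  shows "invertible A"
  using assms by (meson invertible_left_inverse matrix_left_invertible_ker)

lemma pos_definite_kernel: "pos_definite A \<Longrightarrow> A *v x = 0 \<Longrightarrow> x = 0"
  unfolding pos_definite_def by (metis inner_zero_right less_irrefl)

lemma pos_definite_invertible: "pos_definite A \<Longrightarrow> invertible A"
  by (rule invertible_if_kernel_trivial) (rule pos_definite_kernel)

lemma matrix_inv_mult_vec: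
  fixes A :: "real^'n^'n"
  assumes "invertible A"
  shows "A *v (matrix_inv A *v x) = x" "matrix_inv A *v (A *v x) = x"
proof -
  have "A ** matrix_inv A = mat 1 \<and> matrix_inv A ** A = mat 1"
    using assms unfolding invertible_def matrix_inv_def by (rule someI_ex)
  then show "A *v (matrix_inv A *v x) = x" "matrix_inv A *v (A *v x) = x"
    by (simp_all add: matrix_vector_mul_assoc)
qed

subsection \<open>The power map of a DC grid\<close>

text \<open>Without an arc from a load to a source, no path starting at a load could reach a source,
  contrary to connectedness.\<close>

lemma kirchhoff_crossing_edge:
  fixes Y :: "real^('n::finite + 'm::finite)^('n + 'm)"
  assumes "kirchhoff Y"
  obtains i j where "Y $ Inl i $ Inr j < 0"
proof -
  obtain E w where E: "\<And>i j. (i, j) \<in> E\<^sup>*" "\<And>i j. (i, j) \<in> E \<Longrightarrow> 0 < w i j" "Y = laplacian E w"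
    using assms unfolding kirchhoff_def by metis
  have "\<exists>i j. (Inl i, Inr j) \<in> E"
  proof (rule ccontr)
    assume no: "\<not> ?thesis"
    have "b \<in> range Inl" if "(a, b) \<in> E\<^sup>*" "a \<in> range Inl" for a b :: "'n + 'm"
      using that
    proof (induction rule: rtrancl_induct)
      case (step b c)
      then show ?case using no by (cases c) auto
    qed
    \<comment> \<open>Types are nonempty, so \<open>undefined\<close> supplies one load and one
      source.\<close>
    from this[OF E(1)[of "Inl undefined" "Inr undefined"]] show False by auto
  qed
  then obtain i j where "(Inl i, Inr j) \<in> E" by blast
  then have "Y $ Inl i $ Inr j < 0" using E(2) by (simp add: E(3) laplacian_def)
  then show ?thesis by (rule that)
qed

locale dc_grid =
  fixes Y :: "real^('n::finite + 'm::finite)^('n + 'm)" and VS :: "real^'m"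
  assumes kirchhoff: "kirchhoff Y"
    and irreducible: "irreducible_matrix (Y_LL Y)"
    and VS_pos: "pos_vec VS"
begin

abbreviation "A \<equiv> Y_LL Y"
abbreviation "I\<^sub>L \<equiv> I_star Y VS"
abbreviation "P \<equiv> P_c Y VS"
abbreviation "h \<equiv> h_mat Y"
abbreviation "\<phi> \<equiv> phi Y VS"

text \<open>Needed for two vectors: \<open>VS\<close>, which gives the properties of
  \<open>I\<^sub>L\<close>, and \<open>1\<close>, which gives the row sums of
  \<open>A\<close>.\<close>

lemma semipositive_source_weights:
  assumes "pos_vec v"
  shows "0 \<le> (- (Y_LS Y *v v)) $ i" "- (Y_LS Y *v v) \<noteq> 0"
proof -
  have eq: "(- (Y_LS Y *v v)) $ k = (\<Sum>j\<in>UNIV. - Y $ Inl k $ Inr j * v $ j)" for k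
    by (simp add: Y_LS_def matrix_vector_mult_def sum_negf)
  have nn: "0 \<le> - Y $ Inl k $ Inr j * v $ j" for k j
    using kirchhoff_off_diagonal[OF kirchhoff, of "Inl k" "Inr j"] assms
    by (simp add: pos_vec_def mult_nonpos_nonneg less_imp_le)
  show "0 \<le> (- (Y_LS Y *v v)) $ i" unfolding eq by (intro sum_nonneg nn)
  obtain k j where kj: "Y $ Inl k $ Inr j < 0" using kirchhoff_crossing_edge[OF kirchhoff] .
  have "0 < (- (Y_LS Y *v v)) $ k"
    unfolding eq
  proof (rule sum_pos2)
    show "0 < - Y $ Inl k $ Inr j * v $ j"
      using kj assms by (simp add: pos_vec_def mult_neg_pos)
  qed (use nn in auto)
  then show "- (Y_LS Y *v v) \<noteq> 0" by (metis less_irrefl zero_index)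
qed

lemma I_nonneg: "0 \<le> I\<^sub>L $ i" and I_nonzero: "I\<^sub>L \<noteq> 0"
  using semipositive_source_weights[OF VS_pos] by (auto simp: I_star_def)

lemma A_symmetric: "A $ i $ j = A $ j $ i"
  using kirchhoff_symmetric[OF kirchhoff] by (auto simp: Y_LL_def transpose_def vec_eq_iff)

lemma A_sym_Z: "irreducible_sym_Z A"
  unfolding irreducible_sym_Z_def
proof (intro conjI allI impI)
  show "transpose A = A" by (simp add: transpose_def vec_eq_iff A_symmetric)
  show "A $ i $ j \<le> 0" if "i \<noteq> j" for i j
    using kirchhoff_off_diagonal[OF kirchhoff, of "Inl i" "Inl j"] that by (simp add: Y_LL_def)
qed (rule irreducible)

text \<open>Zero row sums of \<open>Y\<close> identify \<open>A *v 1\<close> with the total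
  conductances from the loads to the sources, a semipositive vector.\<close>

lemma A_pos_definite: "pos_definite A"
proof -
  have eq: "A *v 1 = - (Y_LS Y *v 1)"
  proof -
    have "(A *v 1) $ i + (Y_LS Y *v 1) $ i = 0" for i
    proof -
      have "(\<Sum>j\<in>UNIV. Y $ Inl i $ j) =
          (\<Sum>j\<in>UNIV. Y $ Inl i $ Inl j) + (\<Sum>j\<in>UNIV. Y $ Inl i $ Inr j)"
        using sum.Plus[of "UNIV::'n set" "UNIV::'m set" "\<lambda>j. Y $ Inl i $ j"] by (simp add: comp_def)
      then show ?thesis using kirchhoff_row_sums[OF kirchhoff, of "Inl i"]
        by (simp add: Y_LL_def Y_LS_def matrix_vector_mult_def)
    qed
    then show ?thesis by (simp add: vec_eq_iff add_eq_0_iff2)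
  qed
  show ?thesis
    by (rule pos_definite_if_semipositive[OF A_sym_Z, of 1])
      (use semipositive_source_weights[of 1] in \<open>auto simp: eq pos_vec_def\<close>)
qed

lemma A_off_diagonal: "i \<noteq> j \<Longrightarrow> A $ i $ j \<le> 0"
  using A_sym_Z by (simp add: irreducible_sym_Z_def)

lemma A_diagonal: "0 < A $ i $ i"
proof -
  have "0 < axis i 1 \<bullet> (A *v axis i 1)"
    using A_pos_definite by (auto simp: pos_definite_def axis_eq_0_iff)
  then show ?thesis by (simp add: inner_axis' matrix_vector_mul_component inner_axis)
qed

lemma A_V_star: "A *v (V_star Y VS - V) = I\<^sub>L - A *v V"
  by (simp add: V_star_def matrix_vector_mult_diff_distrib
      matrix_inv_mult_vec(1)[OF pos_definite_invertible[OF A_pos_definite]])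

lemma P_nth: "P V $ i = V $ i * (I\<^sub>L $ i - (A *v V) $ i)"
  by (simp add: P_c_def A_V_star)

section \<open>The Jacobian, its symmetrization and the matrices \<open>h l\<close>\<close>

abbreviation J :: "real^'n \<Rightarrow> real^'n^'n" where
  "J V \<equiv> jacobian (P_c Y VS) (at V)"

lemma J_nth: "(J V *v x) $ i = x $ i * (I\<^sub>L $ i - (A *v V) $ i) - V $ i * (A *v x) $ i"
  by (simp add: jacobian_P_c A_V_star matrix_vector_mult_diff_rdistrib matrix_vector_mul_assoc[symmetric])

text \<open>For positive \<open>V\<close> this is the Jacobian with its row factors
  \<open>- V $ i\<close> divided out, which restores symmetry. Since \<open>V\<close> enters only
  through the diagonal, \<open>S_sym_Z\<close> holds for every \<open>V\<close>.\<close>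

definition S :: "real^'n \<Rightarrow> real^'n^'n" where
  "S V = A - diag (\<chi> i. (I\<^sub>L $ i - (A *v V) $ i) / V $ i)"

lemma S_nth: "(S V *v x) $ i = (A *v x) $ i - (I\<^sub>L $ i - (A *v V) $ i) / V $ i * x $ i"
  by (simp add: S_def matrix_vector_mult_diff_rdistrib)

lemma J_eq_S: "pos_vec V \<Longrightarrow> (J V *v x) $ i = - (V $ i * (S V *v x) $ i)"
  unfolding J_nth S_nth using pos_vec_nonzero[of V i] by (simp add: field_simps)

lemma S_sym_Z: "irreducible_sym_Z (S V)"
proof (rule irreducible_sym_Z_cong[OF A_sym_Z])
  show "transpose (S V) = S V"
    by (auto simp: S_def transpose_def vec_eq_iff diag_def A_symmetric)
  show "\<exists>c>0. S V $ i $ j = c * A $ i $ j" if "i \<noteq> j" for i j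
    using that by (intro exI[of _ 1]) (simp add: S_def diag_def)
qed

lemma S_kernel_iff_J:
  assumes "pos_vec V"
  shows "S V *v x = 0 \<longleftrightarrow> J V *v x = 0"
  using assms by (simp add: vec_eq_iff J_eq_S pos_vec_def less_imp_neq[symmetric])

lemma h_nth: "(h l *v x) $ i = (l $ i * (A *v x) $ i + (A *v (diag l *v x)) $ i) / 2"
  by (simp add: h_mat_def scaleR_matrix_vector_assoc[symmetric] matrix_vector_mult_add_rdistrib
      matrix_vector_mul_assoc[symmetric])

lemma h_entry: "h l $ i $ j = (l $ i + l $ j) / 2 * A $ i $ j"
proof -
  have "(diag l ** A) $ i $ j = l $ i * A $ i $ j"
    by (simp add: matrix_matrix_mult_def diag_def if_distrib if_distribR cong: if_cong)
  moreover have "(A ** diag l) $ i $ j = A $ i $ j * l $ j"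
    by (simp add: matrix_matrix_mult_def diag_def if_distrib if_distribR cong: if_cong)
  ultimately show ?thesis by (simp add: h_mat_def algebra_simps)
qed

lemma h_sym_Z:
  assumes "pos_vec l"
  shows "irreducible_sym_Z (h l)"
proof (rule irreducible_sym_Z_cong[OF A_sym_Z])
  show "transpose (h l) = h l"
    by (auto simp: transpose_def vec_eq_iff h_entry A_symmetric add.commute)
  show "\<exists>c>0. h l $ i $ j = c * A $ i $ j" for i j
    using assms by (intro exI[of _ "(l $ i + l $ j) / 2"]) (simp add: h_entry pos_vec_def add_pos_pos)
qed

text \<open>The diagonal entries \<open>l $ i * A $ i $ i\<close> of the positive definite matrix
  \<open>h l\<close> are positive, and so are those of \<open>A\<close>.\<close>

lemma Lam_pos:
  assumes "l \<in> Lam Y"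
  shows "pos_vec l"
  unfolding pos_vec_def
proof
  fix i
  have "0 < axis i 1 \<bullet> (h l *v axis i 1)"
    using assms by (auto simp: Lam_def pos_definite_def axis_eq_0_iff)
  then have "0 < l $ i * A $ i $ i"
    by (simp add: inner_axis' matrix_vector_mul_component inner_axis h_entry)
  then show "0 < l $ i" using A_diagonal[of i] by (simp add: zero_less_mult_iff)
qed

section \<open>The critical voltages \<open>\<phi> l\<close>\<close>

lemma diag_I_semipositive:
  assumes "pos_vec l"
  shows "0 \<le> (diag l *v I\<^sub>L) $ i" "diag l *v I\<^sub>L \<noteq> 0"
  using assms I_nonneg I_nonzero
  by (auto simp: pos_vec_def less_imp_le vec_eq_iff less_imp_neq[symmetric])

text \<open>The linear equation says that the gradient of the quadratic function
  \<open>l \<bullet> P V\<close> vanishes at \<open>V\<close>.\<close>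

lemma phi_iff:
  assumes "l \<in> Lam Y"
  shows "V = \<phi> l \<longleftrightarrow> 2 *\<^sub>R (h l *v V) = diag l *v I\<^sub>L"
proof -
  have inv: "invertible (h l)" using assms by (simp add: Lam_def pos_definite_invertible)
  show ?thesis
  proof
    show "V = \<phi> l \<Longrightarrow> 2 *\<^sub>R (h l *v V) = diag l *v I\<^sub>L"
      by (simp add: phi_def matrix_vector_mult_scaleR matrix_inv_mult_vec[OF inv])
    assume "2 *\<^sub>R (h l *v V) = diag l *v I\<^sub>L"
    from this[symmetric] show "V = \<phi> l"
      by (simp add: phi_def matrix_vector_mult_scaleR matrix_inv_mult_vec[OF inv])
  qed
qed

text \<open>The bridge between the two descriptions of critical voltages: \<open>diag V *v l\<close>
  lies in the kernel of \<open>S V\<close> exactly when \<open>V\<close> solves the equation in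
  \<open>phi_iff\<close>.\<close>

lemma S_diag_eq_h:
  assumes "pos_vec V"
  shows "S V *v (diag V *v l) = 2 *\<^sub>R (h l *v V) - diag l *v I\<^sub>L"
proof -
  have "diag V *v l = diag l *v V" by (simp add: vec_eq_iff)
  then have "A *v (diag V *v l) = A *v (diag l *v V)" by simp
  then show ?thesis using pos_vec_nonzero[OF assms]
    by (simp add: vec_eq_iff S_nth h_nth field_simps)
qed

lemma phi_pos:
  assumes l: "l \<in> Lam Y"
  shows "pos_vec (\<phi> l)"
proof (rule pos_definite_inverse_positive)
  have eq: "h l *v \<phi> l = (1/2) *\<^sub>R (diag l *v I\<^sub>L)"
    using phi_iff[OF l, of "\<phi> l"] by (auto simp: vec_eq_iff field_simps)
  show "irreducible_sym_Z (h l)" "pos_definite (h l)"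
    using l h_sym_Z Lam_pos by (auto simp: Lam_def)
  show "0 \<le> (h l *v \<phi> l) $ i" for i
    using diag_I_semipositive(1)[OF Lam_pos[OF l], of i] unfolding eq by simp
  show "h l *v \<phi> l \<noteq> 0" using diag_I_semipositive(2)[OF Lam_pos[OF l]] unfolding eq by simp
qed

text \<open>Completing the square: \<open>l \<bullet> P V\<close> has quadratic part
  \<open>- (V \<bullet> (h l *v V))\<close> and stationary point \<open>\<phi> l\<close>. No sign of
  \<open>V\<close> is assumed.\<close>

lemma inner_P_phi:
  assumes l: "l \<in> Lam Y"
  shows "l \<bullet> P V = l \<bullet> P (\<phi> l) - (V - \<phi> l) \<bullet> (h l *v (V - \<phi> l))"
proof -
  have sym: "transpose (h l) = h l" using l by (simp add: Lam_def pos_definite_def)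
  have A: "transpose A = A" using A_sym_Z by (simp add: irreducible_sym_Z_def)
  have lP: "l \<bullet> P V = (diag l *v I\<^sub>L) \<bullet> V - V \<bullet> (h l *v V)" for V
  proof -
    have "V \<bullet> (h l *v V) = ((diag l *v V) \<bullet> (A *v V) + V \<bullet> (A *v (diag l *v V))) / 2"
      by (simp add: inner_vec_def h_nth sum.distrib[symmetric] sum_divide_distrib algebra_simps)
    also have "\<dots> = (diag l *v V) \<bullet> (A *v V)"
      using inner_symmetric_matrix[OF A, of V "diag l *v V"] by (simp add: inner_commute)
    finally show ?thesis
      by (simp add: inner_vec_def P_nth sum_subtractf[symmetric] algebra_simps)
  qed
  have "diag l *v I\<^sub>L = 2 *\<^sub>R (h l *v \<phi> l)" using phi_iff[OF l, of "\<phi> l"] by simp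
  then show ?thesis
    using inner_symmetric_matrix[OF sym, of "\<phi> l" V]
    by (simp add: lP matrix_vector_mult_diff_distrib inner_diff_left inner_diff_right inner_commute)
qed

lemma P_eq_phi_imp_eq:
  assumes l: "l \<in> Lam Y" and "P V = P (\<phi> l)"
  shows "V = \<phi> l"
proof (rule ccontr)
  assume "V \<noteq> \<phi> l"
  then have "0 < (V - \<phi> l) \<bullet> (h l *v (V - \<phi> l))" using l by (auto simp: Lam_def pos_definite_def)
  then show False using inner_P_phi[OF l, of V] assms(2) by simp
qed

text \<open>The vector \<open>l\<close> is an outer normal: \<open>l \<bullet> P V\<close> is
  largest at \<open>\<phi> l\<close>, so moving from \<open>P (\<phi> l)\<close> in the direction
  \<open>l\<close> leaves the feasible set at once.\<close>

lemma P_phi_in_frontier: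
  assumes l: "l \<in> Lam Y"
  shows "P (\<phi> l) \<in> frontier (feasible Y VS)"
proof -
  have mem: "P (\<phi> l) \<in> feasible Y VS" using phi_pos[OF l] by (auto simp: feasible_def)
  have "P (\<phi> l) \<notin> interior (feasible Y VS)"
  proof
    assume "P (\<phi> l) \<in> interior (feasible Y VS)"
    then obtain e where e: "e > 0" "cball (P (\<phi> l)) e \<subseteq> feasible Y VS" by (auto simp: mem_interior_cball)
    have "l \<noteq> 0" using Lam_pos[OF l] by (auto simp: pos_vec_def)
    define t where "t = e / norm l"
    have t: "t > 0" using e(1) \<open>l \<noteq> 0\<close> by (simp add: t_def)
    have "P (\<phi> l) + t *\<^sub>R l \<in> cball (P (\<phi> l)) e"
      using e(1) \<open>l \<noteq> 0\<close> by (simp add: dist_norm t_def)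
    then obtain V where V: "P (\<phi> l) + t *\<^sub>R l = P V" using e(2) by (auto simp: feasible_def)
    have "l \<bullet> P V \<le> l \<bullet> P (\<phi> l)"
    proof (cases "V = \<phi> l")
      case False
      then have "0 < (V - \<phi> l) \<bullet> (h l *v (V - \<phi> l))" using l by (auto simp: Lam_def pos_definite_def)
      then show ?thesis using inner_P_phi[OF l, of V] by simp
    qed simp
    moreover have "l \<bullet> P V = l \<bullet> P (\<phi> l) + t * (l \<bullet> l)" by (simp flip: V add: inner_add_right)
    moreover have "0 < t * (l \<bullet> l)" using t \<open>l \<noteq> 0\<close> by simp
    ultimately show False by simp
  qed
  then show ?thesis using mem closure_subset by (auto simp: frontier_def)
qed

text \<open>At \<open>\<phi> l\<close> the Jacobian has a positive kernel vector, so the point is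
  not in \<open>D_set Y VS\<close>. It is a limit of points where \<open>S V\<close> is positive
  definite, hence inverse positive; the minus sign in \<open>J_eq_S\<close> then makes the inverse
  Jacobian negative.\<close>

lemma phi_in_frontier_D:
  assumes l: "l \<in> Lam Y"
  shows "\<phi> l \<in> frontier (D_set Y VS)"
proof -
  have pos: "pos_vec (\<phi> l)" and lpos: "pos_vec l" using phi_pos Lam_pos l by auto
  have hinv: "invertible (h l)" using l by (simp add: Lam_def pos_definite_invertible)
  have "\<not> invertible (J (\<phi> l))"
  proof
    assume inv: "invertible (J (\<phi> l))"
    have "S (\<phi> l) *v (diag (\<phi> l) *v l) = 0"
      using phi_iff[OF l, of "\<phi> l"] by (simp add: S_diag_eq_h[OF pos])
    then have "J (\<phi> l) *v (diag (\<phi> l) *v l) = 0" using S_kernel_iff_J[OF pos] by simp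
    then have "diag (\<phi> l) *v l = 0" by (metis matrix_inv_mult_vec(2)[OF inv] matrix_vector_mult_0_right)
    then show False using pos lpos by (auto simp: vec_eq_iff pos_vec_def) (metis less_irrefl)
  qed
  then have "\<phi> l \<notin> interior (D_set Y VS)" using interior_subset by (auto simp: D_set_def)
  moreover have "\<phi> l \<in> closure (D_set Y VS)"
  proof -
    \<comment> \<open>Moving from \<open>\<phi> l\<close> in the direction \<open>x\<close> makes \<open>S V *v (diag V *v l)\<close> a positive vector.\<close>
    define x where "x = matrix_inv (h l) *v 1"
    have hx: "h l *v x = 1" by (simp add: x_def matrix_inv_mult_vec[OF hinv])
    have xpos: "pos_vec x"
      by (rule pos_definite_inverse_positive[OF h_sym_Z[OF lpos]])
        (use l in \<open>auto simp: hx Lam_def\<close>)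
    have inD: "\<phi> l + e *\<^sub>R x \<in> D_set Y VS" if e: "e > 0" for e
    proof -
      define V where "V = \<phi> l + e *\<^sub>R x"
      have Vpos: "pos_vec V" using pos xpos e by (auto simp: V_def pos_vec_def add_pos_pos)
      have "S V *v (diag V *v l) = (2 * e) *\<^sub>R 1"
        using phi_iff[OF l, of "\<phi> l"]
        by (simp add: S_diag_eq_h[OF Vpos])
          (simp add: V_def matrix_vector_right_distrib matrix_vector_mult_scaleR hx scaleR_add_right)
      moreover have "pos_vec (diag V *v l)" using Vpos lpos by (simp add: pos_vec_def)
      ultimately have pd: "pos_definite (S V)"
        using e by (intro pos_definite_if_semipositive[OF S_sym_Z, of "diag V *v l"]) auto
      have inv: "invertible (J V)"
        using pos_definite_kernel[OF pd] S_kernel_iff_J[OF Vpos] by (intro invertible_if_kernel_trivial) blast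
      have "matrix_inv (J V) $ i $ j < 0" for i j
      proof -
        \<comment> \<open>Column \<open>j\<close> of the inverse Jacobian; its negative is mapped by
          \<open>S V\<close> to a nonnegative multiple of a unit vector.\<close>
        define z where "z = matrix_inv (J V) *v axis j 1"
        have "J V *v z = axis j 1" by (simp add: z_def matrix_inv_mult_vec[OF inv])
        then have *: "V $ k * (S V *v (- z)) $ k = (axis j 1 :: real^'n) $ k" for k
          using J_eq_S[OF Vpos, of z k] by (simp add: vec.neg)
        have Vk: "0 < V $ k" for k using Vpos by (simp add: pos_vec_def)
        have "pos_vec (- z)"
        proof (rule pos_definite_inverse_positive[OF S_sym_Z pd])
          show "0 \<le> (S V *v (- z)) $ k" for k
          proof -
            have "0 \<le> V $ k * (S V *v (- z)) $ k" unfolding * by (simp add: axis_nth_if)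
            then show ?thesis using Vk[of k] by (simp add: zero_le_mult_iff)
          qed
          show "S V *v (- z) \<noteq> 0" using *[of j] by auto
        qed
        then show ?thesis by (simp add: pos_vec_def z_def matrix_vector_mul_component inner_axis)
      qed
      then show ?thesis using Vpos inv by (auto simp: D_set_def V_def)
    qed
    have "((\<lambda>e. \<phi> l + e *\<^sub>R x) \<longlongrightarrow> \<phi> l + 0 *\<^sub>R x) (at_right 0)" by (intro tendsto_intros)
    moreover have "eventually (\<lambda>e. \<phi> l + e *\<^sub>R x \<in> closure (D_set Y VS)) (at_right 0)"
      using eventually_at_right_less[of "0::real"]
      by eventually_elim (use inD closure_subset in blast)
    ultimately show ?thesis
      using Lim_in_closed_set[of "closure (D_set Y VS)" "\<lambda>e. \<phi> l + e *\<^sub>R x" "at_right 0" "\<phi> l"] by simp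
  qed
  ultimately show ?thesis by (simp add: frontier_def)
qed

text \<open>With \<open>V\<close> the common value, \<open>diag V *v l\<close> and
  \<open>diag V *v k\<close> both lie in the kernel of \<open>S V\<close>, which a positive vector
  spans. The normalization fixes the remaining factor.\<close>

lemma Lam_one_unique:
  assumes "l \<in> Lam_one Y" "k \<in> Lam_one Y" "\<phi> l = \<phi> k"
  shows "l = k"
proof -
  have L: "l \<in> Lam Y" "k \<in> Lam Y" using assms by (auto simp: Lam_one_def)
  define V where "V = \<phi> l"
  have Vpos: "pos_vec V" using phi_pos L by (simp add: V_def)
  have Vi: "V $ i \<noteq> 0" for i using Vpos by (rule pos_vec_nonzero)
  have "S V *v (diag V *v l) = 0" "S V *v (diag V *v k) = 0"
    using phi_iff[OF L(1), of V] phi_iff[OF L(2), of V] assms(3)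
    unfolding S_diag_eq_h[OF Vpos] by (simp_all add: V_def)
  moreover have "pos_vec (diag V *v l)" using Vpos Lam_pos[OF L(1)] by (simp add: pos_vec_def)
  ultimately obtain c where c: "diag V *v k = c *\<^sub>R (diag V *v l)"
    using positive_kernel_unique[OF S_sym_Z] by metis
  have k: "k $ i = c * l $ i" for i
    using arg_cong[OF c, of "\<lambda>x. x $ i"] Vi[of i] by simp
  have n: "(\<Sum>i\<in>UNIV. l $ i) = 1" "(\<Sum>i\<in>UNIV. k $ i) = 1"
    using assms(1,2) Lam_pos[OF L(1)] Lam_pos[OF L(2)]
    by (simp_all add: Lam_one_def norm_one_def pos_vec_def less_imp_le)
  then have "c = 1" by (simp add: k sum_distrib_left[symmetric])
  then show ?thesis using k by (simp add: vec_eq_iff)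
qed

text \<open>The equation defining \<open>\<phi> l\<close> rearranges to \<open>diag l *v (I\<^sub>L
  - A *v \<phi> l) = A *v (diag l *v \<phi> l)\<close>, so the conjugated matrix yields the load
  currents.\<close>

lemma boundary_demand_eq:
  assumes l: "l \<in> Lam Y"
  shows "boundary_demand Y VS l = P (\<phi> l)"
proof -
  have li: "l $ i \<noteq> 0" for i using Lam_pos[OF l] by (rule pos_vec_nonzero)
  have inv: "invertible (diag l)"
    by (rule invertible_if_kernel_trivial) (use li in \<open>auto simp: vec_eq_iff\<close>)
  have "diag l *v I\<^sub>L = 2 *\<^sub>R (h l *v \<phi> l)" using phi_iff[OF l, of "\<phi> l"] by simp
  then have nth: "(diag l *v I\<^sub>L) $ i = (2 *\<^sub>R (h l *v \<phi> l)) $ i" for i by simp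
  have "l $ i * I\<^sub>L $ i = l $ i * (A *v \<phi> l) $ i + (A *v (diag l *v \<phi> l)) $ i" for i
    using nth[of i] by (simp add: h_nth)
  then have "diag l *v (I\<^sub>L - A *v \<phi> l) = A *v (diag l *v \<phi> l)"
    by (simp add: vec_eq_iff right_diff_distrib)
  then have "matrix_inv (diag l) *v (A *v (diag l *v \<phi> l)) = I\<^sub>L - A *v \<phi> l"
    by (metis matrix_inv_mult_vec(2)[OF inv])
  then show ?thesis
    by (simp add: boundary_demand_def matrix_vector_mul_assoc[symmetric] vec_eq_iff P_nth)
qed

subsection \<open>Boundary demands\<close>

text \<open>The total power is \<open>I\<^sub>L \<bullet> V - V \<bullet> (A *v V)\<close>. Its
  negative definite quadratic part dominates for large \<open>V\<close>, while the total is at least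
  \<open>CARD('n) * c\<close>.\<close>

lemma superlevel_bounded: "bounded {V. \<forall>i. c \<le> P V $ i}"
proof -
  obtain \<mu> where \<mu>: "0 < \<mu>" and lower: "\<And>x. \<mu> * (x \<bullet> x) \<le> x \<bullet> (A *v x)"
    by (rule perron_pos_definite[OF A_sym_Z A_pos_definite]) (rule that)
  define N where "N = norm I\<^sub>L + \<bar>CARD('n) * c\<bar>"
  have "norm V \<le> max 1 (N / \<mu>)" if V: "\<forall>i. c \<le> P V $ i" for V
  proof (cases "norm V \<le> 1")
    case False
    have "CARD('n) * c \<le> (\<Sum>i\<in>UNIV. P V $ i)"
      using sum_mono[of UNIV "\<lambda>_. c" "\<lambda>i. P V $ i"] V by simp
    also have "\<dots> = I\<^sub>L \<bullet> V - V \<bullet> (A *v V)"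
      by (simp add: inner_vec_def P_nth sum_subtractf[symmetric] algebra_simps)
    also have "\<dots> \<le> norm I\<^sub>L * norm V - \<mu> * (V \<bullet> V)"
      using lower[of V] norm_cauchy_schwarz[of "I\<^sub>L" V] by linarith
    finally have "\<mu> * (norm V)\<^sup>2 \<le> norm I\<^sub>L * norm V + \<bar>CARD('n) * c\<bar> * 1"
      by (simp add: dot_square_norm)
    \<comment> \<open>As \<open>norm V\<close> exceeds 1, the constant term may be multiplied by it,
      so that one factor \<open>norm V\<close> cancels.\<close>
    also have "\<dots> \<le> norm I\<^sub>L * norm V + \<bar>CARD('n) * c\<bar> * norm V"
      using False by (intro add_left_mono mult_left_mono) auto
    finally have "(\<mu> * norm V) * norm V \<le> N * norm V"
      by (simp add: N_def power2_eq_square algebra_simps)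
    then have "\<mu> * norm V \<le> N" by (rule mult_right_le_imp_le) (use False in linarith)
    then show ?thesis using \<mu> by (simp add: pos_le_divide_eq mult.commute le_max_iff_disj)
  qed simp
  then show ?thesis by (auto simp: bounded_iff)
qed

lemma P_continuous: "continuous_on X P"
  by (meson P_c_has_derivative has_derivative_continuous continuous_at_imp_continuous_on)

lemma compact_superlevel: "compact {V. (\<forall>i. 0 \<le> V $ i) \<and> (\<forall>i. p $ i \<le> P V $ i)}"
proof -
  have "closed {V. (\<forall>i. 0 \<le> V $ i) \<and> (\<forall>i. p $ i \<le> P V $ i)}"
    by (intro closed_Collect_conj closed_Collect_all closed_Collect_le continuous_intros P_continuous)
  moreover have "{V. (\<forall>i. 0 \<le> V $ i) \<and> (\<forall>i. p $ i \<le> P V $ i)} \<subseteq> {V. \<forall>i. - norm p \<le> P V $ i}"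
    using component_le_norm_cart[of p] by (auto simp: abs_le_iff) (smt (verit))
  ultimately show ?thesis
    using superlevel_bounded bounded_subset compact_eq_bounded_closed by blast
qed

text \<open>All feasible demands near \<open>p\<close> come from one compact set of nonnegative
  voltages, whose image is closed. Passing to the limit may lose strict positivity.\<close>

lemma closure_feasible_superlevel:
  assumes "p \<in> closure (feasible Y VS)"
  shows "\<exists>V. (\<forall>i. 0 \<le> V $ i) \<and> P V = p"
proof -
  \<comment> \<open>Demands at distance less than 1 from \<open>p\<close> are at least
    \<open>p - 1\<close> in each coordinate.\<close>
  define K where "K = {V. (\<forall>i. 0 \<le> V $ i) \<and> (\<forall>i. (p - 1) $ i \<le> P V $ i)}"
  have "compact (P ` K)"
    unfolding K_def by (intro compact_continuous_image P_continuous compact_superlevel)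
  moreover have "feasible Y VS \<inter> ball p 1 \<subseteq> P ` K"
  proof
    fix q assume q: "q \<in> feasible Y VS \<inter> ball p 1"
    then obtain V where V: "pos_vec V" "q = P V" by (auto simp: feasible_def)
    have "(p - 1) $ i \<le> q $ i" for i
      using component_le_norm_cart[of "p - q" i] q by (auto simp: dist_norm abs_le_iff)
    then show "q \<in> P ` K" using V by (auto simp: K_def pos_vec_def less_imp_le)
  qed
  ultimately have "closure (feasible Y VS \<inter> ball p 1) \<subseteq> P ` K"
    by (intro closure_minimal compact_imp_closed)
  moreover have "p \<in> closure (feasible Y VS \<inter> ball p 1)"
    using assms open_Int_closure_subset[of "ball p 1" "feasible Y VS"] by (auto simp: Int_commute)
  ultimately have "p \<in> P ` K" by blast
  then show ?thesis by (auto simp: K_def)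
qed

section \<open>Exact second-order expansion and maximal voltage profiles\<close>

lemma P_add: "P (V + e *\<^sub>R x) $ i = P V $ i + e * (J V *v x) $ i - e\<^sup>2 * (x $ i * (A *v x) $ i)"
  unfolding P_nth J_nth
  by (simp add: matrix_vector_right_distrib matrix_vector_mult_scaleR power2_eq_square algebra_simps)

text \<open>A voltage profile of maximal sum among those that deliver at least the demand \<open>p\<close> cannot be
  enlarged, because raising a voltage does not decrease the power at any other load.\<close>

lemma maximal_not_enlargeable:
  assumes V: "\<And>i. 0 \<le> V $ i" "\<And>i. p $ i \<le> P V $ i"
    and max: "\<And>U. (\<And>i. 0 \<le> U $ i) \<Longrightarrow> (\<And>i. p $ i \<le> P U $ i) \<Longrightarrow> sum (($) U) UNIV \<le> sum (($) V) UNIV"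
    and x: "\<And>i. 0 \<le> x $ i" "x \<noteq> 0"
  shows "\<exists>i. 0 < x $ i \<and> p $ i = P V $ i \<and> (J V *v x) $ i \<le> 0"
proof (rule ccontr)
  assume "\<not> ?thesis"
  then have neg: "p $ i < P V $ i \<or> 0 < (J V *v x) $ i" if "0 < x $ i" for i
    using that V(2)[of i] by force
  have "eventually (\<lambda>e. p $ i \<le> P (V + e *\<^sub>R x) $ i) (at_right 0)" for i
  proof -
    define a b where "a = (J V *v x) $ i" and "b = x $ i * (A *v x) $ i"
    have eq: "P (V + e *\<^sub>R x) $ i = P V $ i + e * (a - e * b)" for e
      by (simp add: P_add a_def b_def power2_eq_square algebra_simps)
    \<comment> \<open>At load \<open>i\<close> either the voltage is unchanged, or there is slack
      that survives small steps, or the power grows to first order.\<close>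
    consider "x $ i = 0" | "p $ i < P V $ i" | "0 < a"
      using neg[of i] x(1)[of i] by (auto simp: a_def order_less_le)
    then show ?thesis
    proof cases
      case 1
      \<comment> \<open>Only off-diagonal entries of row \<open>i\<close> meet nonzero entries of
        \<open>x\<close>. Hence \<open>a\<close> is nonnegative, and the quadratic coefficient
        \<open>b\<close> is zero.\<close>
      have "(A *v x) $ i \<le> 0"
        unfolding matrix_vector_mult_def
        using A_off_diagonal[of i] x(1) 1 by (auto intro!: sum_nonpos) (metis mult_nonpos_nonneg mult_zero_right order_refl)
      then have "0 \<le> a" using 1 V(1)[of i] by (simp add: a_def J_nth mult_nonneg_nonpos)
      then show ?thesis using V(2)[of i] eventually_at_right_less[of "0::real"]
        by (auto simp: eq b_def 1 elim!: eventually_mono) (smt (verit) mult_nonneg_nonneg)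
    next
      case 2
      have "((\<lambda>e. P V $ i + e * (a - e * b)) \<longlongrightarrow> P V $ i + 0 * (a - 0 * b)) (at_right 0)"
        by (intro tendsto_intros)
      then have "eventually (\<lambda>e. p $ i < P V $ i + e * (a - e * b)) (at_right 0)"
        using 2 by (intro order_tendstoD(1)) auto
      then show ?thesis by (simp add: eq eventually_mono)
    next
      case 3
      have "((\<lambda>e. a - e * b) \<longlongrightarrow> a - 0 * b) (at_right 0)"
        by (intro tendsto_intros)
      then have "eventually (\<lambda>e. 0 < a - e * b) (at_right 0)"
        using 3 by (intro order_tendstoD(1)) auto
      then show ?thesis using eventually_at_right_less[of "0::real"]
      proof eventually_elim
        case (elim e)
        then have "0 < e * (a - e * b)" by simp
        then show ?case using V(2)[of i] by (simp add: eq)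
      qed
    qed
  qed
  then have "eventually (\<lambda>e. \<forall>i. p $ i \<le> P (V + e *\<^sub>R x) $ i) (at_right 0)"
    by (simp add: eventually_all_finite)
  then have "eventually (\<lambda>e. 0 < e \<and> (\<forall>i. p $ i \<le> P (V + e *\<^sub>R x) $ i)) (at_right 0)"
    using eventually_at_right_less[of "0::real"] by eventually_elim auto
  then obtain e where e: "0 < e" "\<And>i. p $ i \<le> P (V + e *\<^sub>R x) $ i"
    using eventually_happens' trivial_limit_at_right_real by blast
  have "sum (($) (V + e *\<^sub>R x)) UNIV \<le> sum (($) V) UNIV"
    using V(1) x(1) e by (intro max) auto
  then have "e * sum (($) x) UNIV \<le> 0" by (simp add: sum.distrib sum_distrib_left)
  moreover have "0 < sum (($) x) UNIV"
    using inner_pos_vec_pos[of 1 x] x by (simp add: pos_vec_def inner_vec_def)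
  ultimately show False using e(1) by (simp add: mult_le_0_iff)
qed

lemma frontier_feasible_phi:
  assumes p: "p \<in> frontier (feasible Y VS)"
  obtains l where "l \<in> Lam_one Y" "p = P (\<phi> l)"
proof -
  define T where "T = {V. (\<forall>i. 0 \<le> V $ i) \<and> (\<forall>i. p $ i \<le> P V $ i)}"
  have "T \<noteq> {}"
    using closure_feasible_superlevel[of p] p by (fastforce simp: T_def frontier_def)
  moreover have "compact T" unfolding T_def by (rule compact_superlevel)
  moreover have "continuous_on T (\<lambda>V. sum (($) V) UNIV)" by (intro continuous_intros)
  ultimately obtain V where V: "V \<in> T" "\<And>U. U \<in> T \<Longrightarrow> sum (($) U) UNIV \<le> sum (($) V) UNIV"
    using continuous_attains_sup[of T] by metis
  have max: "\<exists>i. 0 < x $ i \<and> p $ i = P V $ i \<and> (J V *v x) $ i \<le> 0"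
    if "\<And>i. 0 \<le> x $ i" "x \<noteq> 0" for x
    using V that by (intro maximal_not_enlargeable) (auto simp: T_def)
  \<comment> \<open>Raising the voltage at \<open>i\<close> alone leaves \<open>i\<close> as the
    only possible obstruction, so each demand is met exactly and each diagonal entry of the Jacobian
    is nonpositive.\<close>
  have ax: "p $ i = P V $ i \<and> (J V *v axis i 1) $ i \<le> 0" for i
  proof -
    obtain k where "0 < (axis i 1 :: real^'n) $ k" "p $ k = P V $ k" "(J V *v axis i 1) $ k \<le> 0"
      using max[of "axis i 1"] by (metis axis_eq_0_iff axis_nth_if order_refl zero_le_one zero_neq_one)
    then show ?thesis by (auto simp: axis_nth_if split: if_splits)
  qed
  have PV: "P V = p" using ax by (simp add: vec_eq_iff)
  \<comment> \<open>For \<open>V $ i = 0\<close> the diagonal Jacobian entry reduces to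
    \<open>I\<^sub>L $ i - (A *v V) $ i\<close>.\<close>
  have zero: "I\<^sub>L $ i \<le> (A *v V) $ i" if "V $ i = 0" for i
    using ax[of i] that by (simp add: J_nth)
  have "V = 0 \<or> pos_vec V"
  proof (rule nonneg_zero_or_pos[OF A_sym_Z])
    show "0 \<le> V $ i" for i using V(1) by (simp add: T_def)
    show "0 \<le> (A *v V) $ i" if "V $ i = 0" for i using zero[OF that] I_nonneg[of i] by simp
  qed
  moreover have "V \<noteq> 0"
  proof
    assume "V = 0"
    then have "I\<^sub>L $ i = 0" for i using zero[of i] I_nonneg[of i] by simp
    then show False using I_nonzero by (simp add: vec_eq_iff)
  qed
  ultimately have Vpos: "pos_vec V" by simp
  then have Vi: "0 < V $ i" for i by (simp add: pos_vec_def)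
  obtain \<mu> y where y: "pos_vec y" "S V *v y = \<mu> *\<^sub>R y" "\<And>x. \<mu> * (x \<bullet> x) \<le> x \<bullet> (S V *v x)"
    by (rule perron_symmetric[OF S_sym_Z[of V]]) (rule that)
  have yi: "0 < y $ i" for i using y(1) by (simp add: pos_vec_def)
  have "y \<noteq> 0" using yi by (metis less_irrefl zero_index)
  \<comment> \<open>The positive eigenvector is an admissible direction of increase; since
    \<open>J V *v y\<close> has entries \<open>- (V $ i * (\<mu> * y $ i))\<close>, maximality
    excludes \<open>\<mu> < 0\<close>.\<close>
  then obtain i where "(J V *v y) $ i \<le> 0" using max[of y] yi less_imp_le by blast
  then have "0 \<le> V $ i * (\<mu> * y $ i)" by (simp add: J_eq_S[OF Vpos] y(2))
  then have "0 \<le> \<mu>" using Vi[of i] yi[of i] by (simp add: zero_le_mult_iff)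
  moreover have "\<not> 0 < \<mu>"
  proof
    assume "0 < \<mu>"
    have "invertible (J V)"
    proof (rule invertible_if_kernel_trivial)
      fix x assume "J V *v x = 0"
      then have "S V *v x = 0" by (rule iffD2[OF S_kernel_iff_J[OF Vpos]])
      then have "\<mu> * (x \<bullet> x) \<le> 0" using y(3)[of x] by (metis inner_zero_right)
      then have "x \<bullet> x \<le> 0" using \<open>0 < \<mu>\<close> by (simp only: mult_le_0_iff) linarith
      then show "x = 0" using inner_gt_zero_iff[of x] by linarith
    qed
    then have "(*v) (J V) \<circ> (*v) (matrix_inv (J V)) = id"
      by (auto simp: fun_eq_iff matrix_inv_mult_vec)
    moreover have "(P has_derivative (*v) (J V)) (at V)"
      using P_c_has_derivative[of Y VS V] by (simp add: jacobian_P_c)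
    moreover have "open {V :: real^'n. pos_vec V}"
      unfolding pos_vec_def Collect_all_eq
      by (intro open_INT ballI finite open_Collect_less continuous_intros)
    \<comment> \<open>The positive voltages form an open neighbourhood of \<open>V\<close>. As the
      derivative has a right inverse, their image is a neighbourhood of \<open>P V\<close>.\<close>
    ultimately have "P V \<in> interior (feasible Y VS)"
      unfolding feasible_def using Vpos
      by (intro sussmann_open_mapping[where f' = "(*v) (J V)" and g' = "(*v) (matrix_inv (J V))",
            OF open_UNIV P_continuous UNIV_I])
        (simp_all add: interior_open matrix_vector_mul_bounded_linear)
    then show False using p PV by (simp add: frontier_def)
  qed
  ultimately have "S V *v y = 0" using y(2) by simp
  \<comment> \<open>Dividing \<open>y\<close> by \<open>V\<close> makes \<open>diag V *v l\<close> a
    multiple of \<open>y\<close>, and \<open>s\<close> scales \<open>l\<close> to 1-norm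
    one.\<close>
  define s where "s = (\<Sum>i\<in>UNIV. y $ i / V $ i)"
  have s: "0 < s" unfolding s_def using yi Vi by (intro sum_pos) auto
  define l :: "real^'n" where "l = (\<chi> i. y $ i / V $ i / s)"
  have lpos: "pos_vec l" using yi Vi s by (simp add: l_def pos_vec_def)
  have "diag V *v l = (1 / s) *\<^sub>R y"
    using pos_vec_nonzero[OF Vpos] by (simp add: vec_eq_iff l_def)
  then have "S V *v (diag V *v l) = 0" using \<open>S V *v y = 0\<close> by (simp add: matrix_vector_mult_scaleR)
  then have hV: "2 *\<^sub>R (h l *v V) = diag l *v I\<^sub>L" by (simp add: S_diag_eq_h[OF Vpos])
  \<comment> \<open>The voltage \<open>V\<close> itself is the positive vector with semipositive
    image.\<close>
  have "pos_definite (h l)"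
  proof (rule pos_definite_if_semipositive[OF h_sym_Z[OF lpos] Vpos])
    show "0 \<le> (h l *v V) $ i" for i
      using diag_I_semipositive(1)[OF lpos, of i] unfolding hV[symmetric] by simp
    show "h l *v V \<noteq> 0" using diag_I_semipositive(2)[OF lpos] unfolding hV[symmetric] by simp
  qed
  then have l: "l \<in> Lam Y" by (simp add: Lam_def)
  have "norm_one l = (\<Sum>i\<in>UNIV. y $ i / V $ i) / s"
    using yi Vi s by (simp add: norm_one_def l_def sum_divide_distrib less_imp_le)
  then have "l \<in> Lam_one Y" using l s by (simp add: Lam_one_def s_def[symmetric])
  moreover have "V = \<phi> l" using phi_iff[OF l] hV by simp
  ultimately show ?thesis using that[of l] PV by metis
qed

end

section \<open>Unique representation and parametrization of the boundary\<close>

theorem corollary3p9: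
  fixes Y :: "real^('n::finite + 'm::finite)^('n + 'm)" and VS :: "real^'m"
  assumes "kirchhoff Y"
    and "irreducible_matrix (Y_LL Y)"
    and "pos_vec VS"
  shows "(\<forall>P \<in> frontier (feasible Y VS).
            (\<exists>!(V, l). V \<in> frontier (D_set Y VS) \<and> l \<in> Lam_one Y \<and> P = P_c Y VS V \<and> V = phi Y VS l) \<and>
            (\<forall>V l. V \<in> frontier (D_set Y VS) \<and> l \<in> Lam_one Y \<and> P = P_c Y VS V \<and> V = phi Y VS l
                \<longrightarrow> P = boundary_demand Y VS l)) \<and>
         frontier (feasible Y VS) = {boundary_demand Y VS l | l. l \<in> Lam_one Y}"
proof -
  interpret dc_grid Y VS using assms by unfold_locales
  have L: "l \<in> Lam Y" if "l \<in> Lam_one Y" for l using that by (simp add: Lam_one_def)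
  have ex1: "\<exists>!(V, l). V \<in> frontier (D_set Y VS) \<and> l \<in> Lam_one Y \<and> p = P_c Y VS V \<and> V = phi Y VS l"
    if "p \<in> frontier (feasible Y VS)" for p
  proof -
    obtain l where l: "l \<in> Lam_one Y" "p = P_c Y VS (phi Y VS l)"
      using frontier_feasible_phi[OF \<open>p \<in> _\<close>] .
    show ?thesis
    proof (rule ex1I[of _ "(phi Y VS l, l)"])
      show "case (phi Y VS l, l) of (V, l) \<Rightarrow>
          V \<in> frontier (D_set Y VS) \<and> l \<in> Lam_one Y \<and> p = P_c Y VS V \<and> V = phi Y VS l"
        using l phi_in_frontier_D[OF L[OF l(1)]] by simp
      fix z assume "case z of (V, l) \<Rightarrow>
          V \<in> frontier (D_set Y VS) \<and> l \<in> Lam_one Y \<and> p = P_c Y VS V \<and> V = phi Y VS l"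
      then obtain k where k: "z = (phi Y VS k, k)" "k \<in> Lam_one Y" "p = P_c Y VS (phi Y VS k)"
        by (cases z) auto
      \<comment> \<open>The voltage \<open>\<phi> l\<close> is the only preimage of its power
        vector; once the voltages agree, so do the normalized weights.\<close>
      have "phi Y VS k = phi Y VS l" using P_eq_phi_imp_eq[OF L[OF l(1)]] l(2) k(3) by simp
      then show "z = (phi Y VS l, l)" using Lam_one_unique[OF k(2) l(1)] k(1) by simp
    qed
  qed
  have "frontier (feasible Y VS) = {boundary_demand Y VS l | l. l \<in> Lam_one Y}"
  proof safe
    fix p assume "p \<in> frontier (feasible Y VS)"
    then obtain l where "l \<in> Lam_one Y" "p = P (\<phi> l)" by (rule frontier_feasible_phi)
    then show "\<exists>l. p = boundary_demand Y VS l \<and> l \<in> Lam_one Y"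
      using boundary_demand_eq L by metis
  next
    fix l assume "l \<in> Lam_one Y"
    then show "boundary_demand Y VS l \<in> frontier (feasible Y VS)"
      using P_phi_in_frontier boundary_demand_eq L by auto
  qed
  then show ?thesis using ex1 boundary_demand_eq L by simp
qed

end
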